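(* Let $N\ge 1$ and let $C_1,C_2\in\mathbb{C}^{N\times N}$ be indefinite Hermitian matrices. For a unit-norm vector $u\in\mathbb{C}^{N}$ put $c_i(u)=u^{H}C_iu\in\mathbb{R}$, $i=1,2$. Consider the two optimization problems $$\text{(P)}\qquad p^{\star}=\min_{p>0,\ u\in\mathbb{C}^N,\ \|u\|_2=1}\ p\quad\text{subject to}\quad p\,c_i(u)+1\le 0,\ i=1,2,$$ $$\text{(M)}\qquad c^{\star}=\min_{u\in\mathbb{C}^N,\ \|u\|_2=1}\ \max\bigl(c_1(u),c_2(u)\bigr).$$ Assume that (P) is feasible, i.e. there exists a unit vector $u$ with $c_1(u)<0$ and $c_2(u)<0$. If $u_{\mathrm{opt}}$ is a solution (minimizer) of (M), then $u_{\mathrm{opt}}$ is also a solution of (P) (that is, the pair $(p^{\star},u_{\mathrm{opt}})$ is feasible and optimal for (P)), and $p^{\star}=-1/c^{\star}$.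
   Context: $u^{H}$ denotes the conjugate transpose of $u$, and $\|\cdot\|_2$ the Euclidean norm. Problem (P) arises from the homogeneous quadratic problem $\min_{z\in\mathbb{C}^N} z^{H}z$ subject to $z^{H}C_iz+1\le 0$ by writing $z=\sqrt{p}\,u$ with $p>0$ and $\|u\|_2=1$. *)

theory Defs
  imports "HOL-Analysis.Analysis"
begin

definition conj_transpose :: "complex ^ 'n ^ 'm \<Rightarrow> complex ^ 'm ^ 'n" where
  "conj_transpose A = (\<chi> i j. cnj (A $ j $ i))"

definition hermitian :: "complex ^ 'n ^ 'n \<Rightarrow> bool" where
  "hermitian A \<longleftrightarrow> conj_transpose A = A"

text \<open>The complex number \<open>u\<^sup>H A u\<close>.\<close>

definition sesq :: "complex ^ 'n ^ 'n \<Rightarrow> complex ^ 'n \<Rightarrow> complex" where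
  "sesq A u = (\<Sum>i\<in>UNIV. cnj (u $ i) * (A *v u) $ i)"

text \<open>Taking the real part discards nothing for Hermitian \<open>A\<close>; see \<open>hermitian_sesq\<close>.\<close>

definition quad_form :: "complex ^ 'n ^ 'n \<Rightarrow> complex ^ 'n \<Rightarrow> real" where
  "quad_form A u = Re (sesq A u)"

lemma hermitian_sesq:
  assumes "hermitian A"
  shows "sesq A u = of_real (quad_form A u)"
proof -
  have A: "cnj (A $ i $ j) = A $ j $ i" for i j
    using assms unfolding hermitian_def conj_transpose_def
    by (metis vec_lambda_beta)
  have "cnj (sesq A u) = (\<Sum>i\<in>UNIV. \<Sum>j\<in>UNIV. u $ i * (A $ j $ i * cnj (u $ j)))"
    by (simp add: sesq_def matrix_vector_mult_def sum_distrib_left A)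
  also have "\<dots> = (\<Sum>j\<in>UNIV. \<Sum>i\<in>UNIV. u $ i * (A $ j $ i * cnj (u $ j)))"
    by (rule sum.swap)
  also have "\<dots> = sesq A u"
    by (simp add: sesq_def matrix_vector_mult_def sum_distrib_left mult_ac)
  finally show ?thesis
    unfolding quad_form_def by (metis Reals_cnj_iff of_real_Re)
qed

text \<open>For a Hermitian matrix: neither positive nor negative semidefinite.\<close>

definition indefinite :: "complex ^ 'n ^ 'n \<Rightarrow> bool" where
  "indefinite A \<longleftrightarrow> (\<exists>x. quad_form A x > 0) \<and> (\<exists>x. quad_form A x < 0)"

definition P_feasible ::
  "complex ^ 'n ^ 'n \<Rightarrow> complex ^ 'n ^ 'n \<Rightarrow> real \<times> (complex ^ 'n) \<Rightarrow> bool" where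
  "P_feasible C1 C2 = (\<lambda>(p, u). p > 0 \<and> norm u = 1 \<and>
     p * quad_form C1 u + 1 \<le> 0 \<and> p * quad_form C2 u + 1 \<le> 0)"

text \<open>
  The optimal values are infima over the feasible points. An infimum is the minimum
  exactly when it is attained; attainment is expressed by \<open>P_solution\<close> and \<open>M_solution\<close>.
\<close>

definition P_value :: "complex ^ 'n ^ 'n \<Rightarrow> complex ^ 'n ^ 'n \<Rightarrow> real" where
  "P_value C1 C2 = (INF x \<in> Collect (P_feasible C1 C2). fst x)"

definition P_solution ::
  "complex ^ 'n ^ 'n \<Rightarrow> complex ^ 'n ^ 'n \<Rightarrow> real \<times> (complex ^ 'n) \<Rightarrow> bool" where
  "P_solution C1 C2 = is_arg_min fst (P_feasible C1 C2)"

definition M_value :: "complex ^ 'n ^ 'n \<Rightarrow> complex ^ 'n ^ 'n \<Rightarrow> real" where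
  "M_value C1 C2 = (INF u \<in> {u. norm u = 1}. max (quad_form C1 u) (quad_form C2 u))"

definition M_solution ::
  "complex ^ 'n ^ 'n \<Rightarrow> complex ^ 'n ^ 'n \<Rightarrow> complex ^ 'n \<Rightarrow> bool" where
  "M_solution C1 C2 =
     is_arg_min (\<lambda>u. max (quad_form C1 u) (quad_form C2 u)) (\<lambda>u. norm u = 1)"

lemma P_feasible_iff:
  "(\<exists>x. P_feasible C1 C2 x) \<longleftrightarrow>
   (\<exists>u. norm u = 1 \<and> quad_form C1 u < 0 \<and> quad_form C2 u < 0)"
proof
  assume "\<exists>x. P_feasible C1 C2 x"
  then obtain p u where x: "p > 0" "norm u = 1"
    "p * quad_form C1 u + 1 \<le> 0" "p * quad_form C2 u + 1 \<le> 0"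
    by (auto simp: P_feasible_def)
  have "c < 0" if "p * c + 1 \<le> 0" for c
    using that mult_nonneg_nonneg[of p c] x(1) by linarith
  with x show "\<exists>u. norm u = 1 \<and> quad_form C1 u < 0 \<and> quad_form C2 u < 0"
    by blast
next
  assume "\<exists>u. norm u = 1 \<and> quad_form C1 u < 0 \<and> quad_form C2 u < 0"
  then obtain u where u: "norm u = 1" "quad_form C1 u < 0" "quad_form C2 u < 0"
    by blast
  define m where "m = max (quad_form C1 u) (quad_form C2 u)"
  have m: "m < 0" using u by (simp add: m_def)
  have "(- 1 / m) * c + 1 \<le> 0" if "c \<le> m" for c
    using that m by (simp add: field_simps)
  then have "P_feasible C1 C2 (- 1 / m, u)"
    using u m by (simp add: P_feasible_def m_def divide_neg_neg)
  then show "\<exists>x. P_feasible C1 C2 x" by blast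
qed

end

theory Submission
  imports Defs
begin

text \<open>
  Write \<open>m u = max (c\<^sub>1 u) (c\<^sub>2 u)\<close> for a unit vector \<open>u\<close>. For a fixed direction \<open>u\<close> the scaling \<open>p\<close>
  is feasible exactly when \<open>m u < 0\<close> and \<open>p \<ge> - 1 / m u\<close> (\<open>P_feasible_iff_max\<close>), so the cheapest
  scaling along \<open>u\<close> costs \<open>- 1 / m u\<close>. The map \<open>t \<mapsto> - 1 / t\<close> is increasing on the negative reals;
  hence the cheapest direction is the one that minimizes \<open>m\<close>. Feasibility of (P) guarantees that
  the minimum of \<open>m\<close> is negative, so that this monotonicity applies.
\<close>

lemma P_feasible_iff_max:
  "P_feasible C1 C2 (p, u) \<longleftrightarrow>
     norm u = 1 \<and> max (quad_form C1 u) (quad_form C2 u) < 0 \<and>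
     - 1 / max (quad_form C1 u) (quad_form C2 u) \<le> p"
proof -
  define m where "m = max (quad_form C1 u) (quad_form C2 u)"
  \<comment> \<open>For \<open>p > 0\<close> both constraints say \<open>c\<^sub>i u \<le> - 1 / p\<close>, hence together \<open>m \<le> - 1 / p\<close>.\<close>
  have max: "p * quad_form C1 u + 1 \<le> 0 \<and> p * quad_form C2 u + 1 \<le> 0 \<longleftrightarrow> p * m + 1 \<le> 0"
    if "p > 0"
  proof -
    have "p * c + 1 \<le> 0 \<longleftrightarrow> c \<le> - 1 / p" for c
      using that by (simp add: field_simps, linarith)
    then show ?thesis
      by (simp add: m_def)
  qed
  have solve: "p > 0 \<and> p * m + 1 \<le> 0 \<longleftrightarrow> m < 0 \<and> - 1 / m \<le> p"
  proof -
    have "- 1 / m \<le> p \<longleftrightarrow> p * m + 1 \<le> 0" if "m < 0"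
      using neg_divide_le_eq[OF that, of "- 1" p] by linarith
    moreover have "m < 0" if "p > 0" "p * m + 1 \<le> 0"
      using that mult_nonneg_nonneg[of p m] by linarith
    moreover have "p > 0" if "m < 0" "- 1 / m \<le> p"
      using that divide_neg_neg[of "- 1" m] by linarith
    ultimately show ?thesis
      by blast
  qed
  show ?thesis
    unfolding P_feasible_def m_def[symmetric] using max solve by auto
qed

lemma INF_eq_if_is_arg_min:
  fixes f :: "'a \<Rightarrow> 'b::{conditionally_complete_lattice, linorder}"
  assumes "is_arg_min f P x"
  shows "(INF y \<in> Collect P. f y) = f x"
  using assms by (intro cInf_eq_minimum) (auto simp: is_arg_min_linorder)

theorem mainTheorem1:
  fixes C1 C2 :: "complex ^ 'n ^ 'n" and u_opt :: "complex ^ 'n"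
  assumes "hermitian C1" and "hermitian C2"
    and "indefinite C1" and "indefinite C2"
    and "\<exists>x. P_feasible C1 C2 x"
    and "M_solution C1 C2 u_opt"
  shows "P_solution C1 C2 (P_value C1 C2, u_opt) \<and> P_value C1 C2 = - 1 / M_value C1 C2"
proof -
  define m where "m = (\<lambda>u. max (quad_form C1 u) (quad_form C2 u))"
  have feasible: "P_feasible C1 C2 (p, u) \<longleftrightarrow> norm u = 1 \<and> m u < 0 \<and> - 1 / m u \<le> p" for p u
    unfolding m_def by (rule P_feasible_iff_max)
  have M: "is_arg_min m (\<lambda>u. norm u = 1) u_opt"
    using assms(6) by (simp add: M_solution_def m_def)
  then have unit: "norm u_opt = 1" and least: "\<And>u. norm u = 1 \<Longrightarrow> m u_opt \<le> m u"
    by (auto simp: is_arg_min_linorder)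
  have M_value: "M_value C1 C2 = m u_opt"
    using INF_eq_if_is_arg_min[OF M] by (simp add: M_value_def m_def)
  have neg: "m u_opt < 0"
    using assms(5) least by (force simp: feasible)
  have "- 1 / m u_opt \<le> p" if "P_feasible C1 C2 (p, u)" for p u
  proof -
    have u: "m u_opt \<le> m u" "m u < 0" "- 1 / m u \<le> p"
      using that least by (auto simp: feasible)
    then have "- 1 / m u_opt \<le> - 1 / m u"
      using neg by (simp add: field_simps)
    with u show ?thesis
      by linarith
  qed
  then have P: "is_arg_min fst (P_feasible C1 C2) (- 1 / m u_opt, u_opt)"
    using unit neg by (auto simp: is_arg_min_linorder feasible)
  have "P_value C1 C2 = - 1 / m u_opt"
    using INF_eq_if_is_arg_min[OF P] by (simp add: P_value_def)
  with P show ?thesis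
    by (simp add: P_solution_def M_value)
qed

end
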